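(* Assume the convex vector optimization problem (P) satisfies: (a) the feasible region $\mathcal{X}$ is a compact subset of $\mathbb{R}^n$; (b) $\mathcal{X}$ has non-empty interior; (c) $\Gamma:X\to\mathbb{R}^q$ is continuous; (d) the ordering cone $C$ is polyhedral and $D=\mathbb{R}^m_+$. Let $\epsilon>0$. Then the Dual Approximation Algorithm (described in the context, with or without the optional break) works correctly: if the algorithm terminates, it returns a finite weak $\epsilon$-solution $\bar{\mathcal{X}}$ to (P) and a finite $\epsilon$-solution $\bar{\mathcal{T}}$ to the geometric dual problem (GD).
   Context: Problem (P). $C\subseteq\mathbb{R}^q$ is a polyhedral convex cone that is non-trivial ($\{0\}\subsetneq C\subsetneq\mathbb{R}^q$), pointed (contains no line) and has nonempty interior; $v\le_C w$ means $w-v\in C$; $X\subseteq\mathbb{R}^n$ is convex; $\Gamma:X\to\mathbb{R}^q$ is $C$-convex, i.e. $\Gamma(\alpha x+(1-\alpha)y)\le_C\alpha\Gamma(x)+(1-\alpha)\Gamma(y)$ for $x,y\in X$, $\alpha\in[0,1]$; with $D=\mathbb{R}^m_+$, $g:X\to\mathbb{R}^m$ is componentwise convex. (P) is: minimize $\Gamma(x)$ with respect to $\le_C$ subject to $x\in\mathcal{X}:=\{x\in X: g(x)\le 0\}$, and $\mathcal{X}\neq\emptyset$. Upper image: $\mathcal{P}:=\operatorname{cl}(\Gamma(\mathcal{X})+C)$. Dual cone: $C^+:=\{z\in\mathbb{R}^q:\ z^\top y\ge0\ \forall y\in C\}$. (Under (a)–(d), (P) is bounded: $\mathcal{P}\subseteq\{y\}+C$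 for some $y\in\mathbb{R}^q$.) Fixed data. $c\in\operatorname{int}C$ and $c^1,\dots,c^{q-1}\in\mathbb{R}^q$ are fixed such that $c^1,\dots,c^{q-1},c$ are linearly independent; $T:=(c^1,\dots,c^{q-1},c)$ is the nonsingular matrix with these columns. For $t\in\mathbb{R}^q$, $w(t):=\big((t_1,\dots,t_{q-1},1)T^{-1}\big)^\top$. For $y,y^*\in\mathbb{R}^q$, $\varphi(y,y^* ):=(y^*_1,\dots,y^*_{q-1},1)T^{-1}y-y^*_q$. Geometric dual (GD). $K:=\{(0,\dots,0,s)^\top: s\ge0\}=\mathbb{R}_+e^q$, with $e^q$ the last unit vector of $\mathbb{R}^q$. (GD) is: maximize $D^*(t):=(t_1,\dots,t_{q-1},\inf_{x\in\mathcal{X}}w(t)^\top\Gamma(x))^\top$ with respect to $\le_K$ over $t\in\mathcal{T}:=\{t\in\mathbb{R}^q:w(t)\in C^+\}$. Lower image: $\mathcal{D}:=\{t\in\mathbb{R}^q: w(t)\in C^+,\ t_q\le\inf_{x\in\mathcal{X}}w(t)^\top\Gamma(x)\}$. Solution concepts. $\bar x\in\mathcal{X}$ is a weak minimizer of (P) if $(\{\Gamma(\bar x)\}-\operatorname{int}C)\cap\Gamma(\mathcal{X})=\emptyset$. A finite weak $\epsilon$-solution to (P) is a nonempty finite set $\bar{\mathcal{X}}\subseteq\mathcal{X}$ of weak minimizers with $\operatorname{conv}\Gamma(\bar{\mathcal{X}})+C-\epsilon\{c\}\supseteq\mathcal{P}$. $\bar t\in\mathcal{T}$ is a maximizer of (GD)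 if there is no $t\in\mathcal{T}$ with $D^*(t)\ge_K D^*(\bar t)$ and $D^*(t)\ne D^*(\bar t)$. A finite $\epsilon$-solution to (GD) is a nonempty finite set $\bar{\mathcal{T}}\subseteq\mathcal{T}$ of maximizers with $\operatorname{conv}D^*(\bar{\mathcal{T}})-K+\epsilon\{e^q\}\supseteq\mathcal{D}$. Scalar problem. P$_1(w)$: $\min\{w^\top\Gamma(x): x\in X,\ g(x)\le0\}$. Dual Approximation Algorithm (input $\epsilon>0$). Let $z^1,\dots,z^J$ be generating vectors of $C^+$ normalized by $c^\top z^j=1$, and $\eta:=\frac1J\sum_{j=1}^Jz^j$. Initialization: compute an optimal solution $x^\eta$ of P$_1(\eta)$; set $\mathcal{D}_0:=\mathcal{T}\cap\{y^*\in\mathbb{R}^q:\varphi(\Gamma(x^\eta),y^* )\ge0\}$, $k:=0$, $\bar{\mathcal{X}}:=\{x^\eta\}$, $\bar{\mathcal{T}}:=\{T^\top\eta\}$. Repeat: set $M:=\mathbb{R}^q$ and compute the set of vertices of the polyhedron $\mathcal{D}_k$. Go through the vertices $t$ one after the other; for each, set $w:=w(t)$, compute an optimal solution $x^w$ of P$_1(w)$ and its optimal value $y^w=w^\top\Gamma(x^w)$; add $x^w$ to $\bar{\mathcal{X}}$; if $w\notin\operatorname{bd}C^+$ or $t_q-y^w\le\epsilon$, add $t$ to $\bar{\mathcal{T}}$; if $t_q-y^w>\epsilon$, replace $M$ by $M\cap\{y^*\in\mathbb{R}^q:\varphi(\Gamma(x^w),y^* )\ge0\}$ and (optional break) stop going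 through the vertices. Afterwards, if $M\ne\mathbb{R}^q$, set $\mathcal{D}_{k+1}:=\mathcal{D}_k\cap M$, increase $k$ by one and repeat; if $M=\mathbb{R}^q$, terminate and return $\bar{\mathcal{X}}$ and $\bar{\mathcal{T}}$. *)

theory Defs
  imports "HOL-Analysis.Analysis"
begin

text \<open>
  The space $\mathbb{R}^q$ is rendered as \<open>real ^ 'q\<close> with a linearly ordered finite index type,
  so that ``the last coordinate'' makes sense; the remaining indices play the role of
  $1, \dots, q-1$.
\<close>

definition last_ix :: "'q::{finite,linorder}"
  where "last_ix = Max UNIV"

subsection \<open>The convex vector optimization problem\<close>

definition cone_le :: "('a::real_vector) set \<Rightarrow> 'a \<Rightarrow> 'a \<Rightarrow> bool"
  where "cone_le C v w \<longleftrightarrow> w - v \<in> C"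

definition contains_line :: "('a::real_vector) set \<Rightarrow> bool"
  where "contains_line C \<longleftrightarrow> (\<exists>a d. d \<noteq> 0 \<and> (\<forall>s::real. a + s *\<^sub>R d \<in> C))"

definition cone_convex_on ::
    "('b::real_vector) set \<Rightarrow> ('a::real_vector) set \<Rightarrow> ('a \<Rightarrow> 'b) \<Rightarrow> bool"
  where "cone_convex_on C X \<Gamma> \<longleftrightarrow>
    (\<forall>x\<in>X. \<forall>y\<in>X. \<forall>\<alpha>\<in>{0..1::real}.
       cone_le C (\<Gamma> (\<alpha> *\<^sub>R x + (1 - \<alpha>) *\<^sub>R y)) (\<alpha> *\<^sub>R \<Gamma> x + (1 - \<alpha>) *\<^sub>R \<Gamma> y))"

definition feasible :: "(real ^ 'n) set \<Rightarrow> (real ^ 'n \<Rightarrow> real ^ 'm) \<Rightarrow> (real ^ 'n) set"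
  where "feasible X g = {x \<in> X. \<forall>i. g x $ i \<le> 0}"

text \<open>In the following definitions \<open>S\<close> is the feasible region.\<close>

definition upper_image ::
    "(real ^ 'q) set \<Rightarrow> (real ^ 'n \<Rightarrow> real ^ 'q) \<Rightarrow> (real ^ 'n) set \<Rightarrow> (real ^ 'q) set"
  where "upper_image C \<Gamma> S = closure {\<Gamma> x + d | x d. x \<in> S \<and> d \<in> C}"

definition dual_cone :: "(real ^ 'q) set \<Rightarrow> (real ^ 'q) set"
  where "dual_cone C = {z. \<forall>y\<in>C. z \<bullet> y \<ge> 0}"

definition weak_minimizer ::
    "(real ^ 'q) set \<Rightarrow> (real ^ 'n \<Rightarrow> real ^ 'q) \<Rightarrow> (real ^ 'n) set \<Rightarrow> real ^ 'n \<Rightarrow> bool"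
  where "weak_minimizer C \<Gamma> S x \<longleftrightarrow>
    x \<in> S \<and> {\<Gamma> x - d | d. d \<in> interior C} \<inter> \<Gamma> ` S = {}"

definition finite_weak_eps_solution ::
    "(real ^ 'q) set \<Rightarrow> (real ^ 'n \<Rightarrow> real ^ 'q) \<Rightarrow> (real ^ 'n) set \<Rightarrow> real ^ 'q \<Rightarrow> real
      \<Rightarrow> (real ^ 'n) set \<Rightarrow> bool"
  where "finite_weak_eps_solution C \<Gamma> S c \<epsilon> Xs \<longleftrightarrow>
    Xs \<noteq> {} \<and> finite Xs \<and> Xs \<subseteq> S \<and> (\<forall>x\<in>Xs. weak_minimizer C \<Gamma> S x) \<and>
    upper_image C \<Gamma> S \<subseteq> {a + d - \<epsilon> *\<^sub>R c | a d. a \<in> convex hull (\<Gamma> ` Xs) \<and> d \<in> C}"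

definition scalar_opt ::
    "(real ^ 'n \<Rightarrow> real ^ 'q) \<Rightarrow> (real ^ 'n) set \<Rightarrow> real ^ 'q \<Rightarrow> real ^ 'n \<Rightarrow> bool"
  where "scalar_opt \<Gamma> S w x \<longleftrightarrow> x \<in> S \<and> (\<forall>x'\<in>S. w \<bullet> \<Gamma> x \<le> w \<bullet> \<Gamma> x')"

subsection \<open>The geometric dual problem\<close>

text \<open>
  These synonyms are needed because \<open>real ^ 'q\<close> forces the sort of \<open>'q\<close> to be just \<open>finite\<close>
  unless every single occurrence of \<open>'q\<close> is annotated.
\<close>

type_synonym 'q rvec = "(real, 'q) vec"
type_synonym 'q rmat = "((real, 'q) vec, 'q) vec"

definition matrix_of_columns :: "('q \<Rightarrow> real ^ 'q) \<Rightarrow> real ^ 'q ^ 'q"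
  where "matrix_of_columns b = (\<chi> i j. b j $ i)"

definition with_last_one :: "'q rvec \<Rightarrow> 'q::{finite,linorder} rvec"
  where "with_last_one t = (\<chi> i. if i = last_ix then 1 else t $ i)"

definition weight :: "'q rmat \<Rightarrow> 'q rvec \<Rightarrow> 'q::{finite,linorder} rvec"
  where "weight T t = with_last_one t v* matrix_inv T"

definition coupling :: "'q rmat \<Rightarrow> 'q rvec \<Rightarrow> 'q::{finite,linorder} rvec \<Rightarrow> real"
  where "coupling T y y' = (with_last_one y' v* matrix_inv T) \<bullet> y - y' $ last_ix"

definition dual_order_cone :: "'q::{finite,linorder} rvec set"
  where "dual_order_cone = {s *\<^sub>R axis last_ix 1 | s. s \<ge> 0}"

definition dual_feasible ::
    "'q rvec set \<Rightarrow> 'q rmat \<Rightarrow> 'q::{finite,linorder} rvec set"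
  where "dual_feasible C T = {t. weight T t \<in> dual_cone C}"

text \<open>
  The infima below are infima of real numbers; they are the genuine ones since the feasible
  region is nonempty and compact and \<open>\<Gamma>\<close> is continuous wherever these definitions are used.
\<close>

definition dual_objective ::
    "(real ^ 'n \<Rightarrow> 'q rvec) \<Rightarrow> (real ^ 'n) set \<Rightarrow> 'q rmat
      \<Rightarrow> 'q rvec \<Rightarrow> 'q::{finite,linorder} rvec"
  where "dual_objective \<Gamma> S T t =
    (\<chi> i. if i = last_ix then (INF x\<in>S. weight T t \<bullet> \<Gamma> x) else t $ i)"

definition lower_image ::
    "'q rvec set \<Rightarrow> (real ^ 'n \<Rightarrow> 'q rvec) \<Rightarrow> (real ^ 'n) set \<Rightarrow> 'q rmat
      \<Rightarrow> 'q::{finite,linorder} rvec set"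
  where "lower_image C \<Gamma> S T =
    {t. weight T t \<in> dual_cone C \<and> t $ last_ix \<le> (INF x\<in>S. weight T t \<bullet> \<Gamma> x)}"

definition dual_maximizer ::
    "'q rvec set \<Rightarrow> (real ^ 'n \<Rightarrow> 'q rvec) \<Rightarrow> (real ^ 'n) set \<Rightarrow> 'q rmat
      \<Rightarrow> 'q::{finite,linorder} rvec \<Rightarrow> bool"
  where "dual_maximizer C \<Gamma> S T t \<longleftrightarrow>
    t \<in> dual_feasible C T \<and>
    \<not> (\<exists>t'\<in>dual_feasible C T.
         cone_le dual_order_cone (dual_objective \<Gamma> S T t) (dual_objective \<Gamma> S T t') \<and>
         dual_objective \<Gamma> S T t' \<noteq> dual_objective \<Gamma> S T t)"

definition finite_eps_solution_dual ::
    "'q rvec set \<Rightarrow> (real ^ 'n \<Rightarrow> 'q rvec) \<Rightarrow> (real ^ 'n) set \<Rightarrow> 'q rmat \<Rightarrow> real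
      \<Rightarrow> 'q::{finite,linorder} rvec set \<Rightarrow> bool"
  where "finite_eps_solution_dual C \<Gamma> S T \<epsilon> Ts \<longleftrightarrow>
    Ts \<noteq> {} \<and> finite Ts \<and> Ts \<subseteq> dual_feasible C T \<and> (\<forall>t\<in>Ts. dual_maximizer C \<Gamma> S T t) \<and>
    lower_image C \<Gamma> S T \<subseteq>
      {a - k + \<epsilon> *\<^sub>R axis last_ix 1 | a k.
         a \<in> convex hull (dual_objective \<Gamma> S T ` Ts) \<and> k \<in> dual_order_cone}"

subsection \<open>The dual approximation algorithm\<close>

definition cut :: "'q rmat \<Rightarrow> 'q rvec \<Rightarrow> 'q::{finite,linorder} rvec set"
  where "cut T y = {y'. coupling T y y' \<ge> 0}"

definition vertices :: "(real ^ 'q) set \<Rightarrow> (real ^ 'q) set"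
  where "vertices P = {v. v extreme_point_of P}"

text \<open>
  The algorithm is nondeterministic in the choice of optimal solutions of the scalar problems
  and in the order in which vertices are visited, so it is given as an input/output relation.
  A triple \<open>(Xs, Ts, M)\<close> holds the current values of the three program variables; the flag \<open>brk\<close>
  says whether the optional break is used.
\<close>

definition visit_vertex ::
    "'q rvec set \<Rightarrow> (real ^ 'n \<Rightarrow> 'q rvec) \<Rightarrow> (real ^ 'n) set \<Rightarrow> 'q rmat \<Rightarrow> real
      \<Rightarrow> 'q::{finite,linorder} rvec \<Rightarrow> real ^ 'n
      \<Rightarrow> (real ^ 'n) set \<times> 'q rvec set \<times> 'q rvec set
      \<Rightarrow> (real ^ 'n) set \<times> 'q rvec set \<times> 'q rvec set"
  where "visit_vertex C \<Gamma> S T \<epsilon> t x = (\<lambda>(Xs, Ts, M).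
    let w = weight T t; y = w \<bullet> \<Gamma> x in
      (insert x Xs,
       if w \<notin> frontier (dual_cone C) \<or> t $ last_ix - y \<le> \<epsilon> then insert t Ts else Ts,
       if t $ last_ix - y > \<epsilon> then M \<inter> cut T (\<Gamma> x) else M))"

inductive go_through ::
    "'q rvec set \<Rightarrow> (real ^ 'n \<Rightarrow> 'q rvec) \<Rightarrow> (real ^ 'n) set \<Rightarrow> 'q rmat \<Rightarrow> real
      \<Rightarrow> bool \<Rightarrow> 'q::{finite,linorder} rvec list
      \<Rightarrow> (real ^ 'n) set \<times> 'q rvec set \<times> 'q rvec set
      \<Rightarrow> (real ^ 'n) set \<times> 'q rvec set \<times> 'q rvec set \<Rightarrow> bool"
  for C \<Gamma> S T \<epsilon> brk
where
  exhausted: "go_through C \<Gamma> S T \<epsilon> brk [] \<sigma> \<sigma>"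
| break_off: "\<lbrakk>scalar_opt \<Gamma> S (weight T t) x;
     brk \<and> t $ last_ix - weight T t \<bullet> \<Gamma> x > \<epsilon>\<rbrakk>
    \<Longrightarrow> go_through C \<Gamma> S T \<epsilon> brk (t # ts) \<sigma> (visit_vertex C \<Gamma> S T \<epsilon> t x \<sigma>)"
| go_on: "\<lbrakk>scalar_opt \<Gamma> S (weight T t) x;
     \<not> (brk \<and> t $ last_ix - weight T t \<bullet> \<Gamma> x > \<epsilon>);
     go_through C \<Gamma> S T \<epsilon> brk ts (visit_vertex C \<Gamma> S T \<epsilon> t x \<sigma>) \<sigma>'\<rbrakk>
    \<Longrightarrow> go_through C \<Gamma> S T \<epsilon> brk (t # ts) \<sigma> \<sigma>'"

text \<open>
  \<open>main_loop C \<Gamma> S T \<epsilon> brk P Xs Ts Xs' Ts'\<close>: the loop, entered with outer polyhedron \<open>P\<close> and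
  sets \<open>Xs\<close>, \<open>Ts\<close>, may terminate after finitely many iterations with the sets \<open>Xs'\<close>, \<open>Ts'\<close>.
\<close>

inductive main_loop ::
    "'q rvec set \<Rightarrow> (real ^ 'n \<Rightarrow> 'q rvec) \<Rightarrow> (real ^ 'n) set \<Rightarrow> 'q rmat \<Rightarrow> real
      \<Rightarrow> bool \<Rightarrow> 'q::{finite,linorder} rvec set
      \<Rightarrow> (real ^ 'n) set \<Rightarrow> 'q rvec set \<Rightarrow> (real ^ 'n) set \<Rightarrow> 'q rvec set \<Rightarrow> bool"
  for C \<Gamma> S T \<epsilon> brk
where
  terminate: "\<lbrakk>distinct ts; set ts = vertices P;
     go_through C \<Gamma> S T \<epsilon> brk ts (Xs, Ts, UNIV) (Xs', Ts', M); M = UNIV\<rbrakk>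
    \<Longrightarrow> main_loop C \<Gamma> S T \<epsilon> brk P Xs Ts Xs' Ts'"
| iterate: "\<lbrakk>distinct ts; set ts = vertices P;
     go_through C \<Gamma> S T \<epsilon> brk ts (Xs, Ts, UNIV) (Xs', Ts', M); M \<noteq> UNIV;
     main_loop C \<Gamma> S T \<epsilon> brk (P \<inter> M) Xs' Ts' Xs'' Ts''\<rbrakk>
    \<Longrightarrow> main_loop C \<Gamma> S T \<epsilon> brk P Xs Ts Xs'' Ts''"

definition dual_algorithm_returns ::
    "'q rvec set \<Rightarrow> (real ^ 'n \<Rightarrow> 'q rvec) \<Rightarrow> (real ^ 'n) set \<Rightarrow> 'q rmat \<Rightarrow> real
      \<Rightarrow> bool \<Rightarrow> nat \<Rightarrow> (nat \<Rightarrow> 'q::{finite,linorder} rvec)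
      \<Rightarrow> (real ^ 'n) set \<Rightarrow> 'q rvec set \<Rightarrow> bool"
  where "dual_algorithm_returns C \<Gamma> S T \<epsilon> brk J z Xs Ts \<longleftrightarrow>
    (let \<eta> = (1 / real J) *\<^sub>R (\<Sum>j=1..J. z j) in
      \<exists>x. scalar_opt \<Gamma> S \<eta> x \<and>
        main_loop C \<Gamma> S T \<epsilon> brk (dual_feasible C T \<inter> cut T (\<Gamma> x))
          {x} {transpose T *v \<eta>} Xs Ts)"

end

theory Submission
  imports Defs
begin

text \<open>
  Every \<open>t\<close> with \<open>w(t) \<in> C\<^sup>+\<close> satisfies \<open>w(t) \<bullet> c = 1\<close>, and \<open>w(t)\<close> ranges over the compact base
  \<open>{w \<in> C\<^sup>+. w \<bullet> c = 1}\<close> of the dual cone. The outer approximations are hypographs over this base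
  of a minimum of finitely many affine functions. A point on the upper boundary of such a hypograph
  lies in the face on which one of these functions is active; this face is compact, so by
  Krein--Milman the point is a convex combination of vertices. On termination every vertex exceeds
  the dual objective by at most \<open>\<epsilon>\<close>, which gives the inclusion for the lower image. If a point \<open>y\<close> of
  the upper image were missed, a separating functional, normalized to lie in the base, would yield a
  point of the outer approximation that exceeds the lower image by more than \<open>\<epsilon>\<close>.
\<close>

section \<open>Weights, couplings and the last coordinate\<close>

lemma weight_vector_matrix_mult:
  assumes "invertible T"
  shows "weight T t v* T = with_last_one t"
  unfolding weight_def vector_matrix_mul_assoc
  using someI_ex[OF assms[unfolded invertible_def]] by (simp add: matrix_inv_def)

lemma weight_of_vector_matrix_mult:
  assumes "invertible T" and "(w v* T) $ last_ix = 1"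
  shows "weight T (w v* T) = w"
proof -
  have "with_last_one (w v* T) = w v* T"
    using assms(2) by (simp add: with_last_one_def vec_eq_iff)
  then show ?thesis
    unfolding weight_def
    using someI_ex[OF assms(1)[unfolded invertible_def]]
    by (simp add: vector_matrix_mul_assoc matrix_inv_def)
qed

text \<open>\<open>with_last_one\<close> overwrites the last coordinate. Hence a move along the last
  axis keeps the weight, and with it dual feasibility, and shifts all couplings by the same
  amount.\<close>

lemma weight_eqI:
  assumes "\<And>i. i \<noteq> last_ix \<Longrightarrow> s $ i = t $ i"
  shows "weight T s = weight T t"
proof -
  have "with_last_one s = with_last_one t"
    using assms by (auto simp: with_last_one_def vec_eq_iff)
  then show ?thesis by (simp add: weight_def)
qed

lemma weight_add_last [simp]: "weight T (t + r *\<^sub>R axis last_ix 1) = weight T t"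
  by (rule weight_eqI) (simp add: axis_def)

lemma weight_diff_last [simp]: "weight T (t - r *\<^sub>R axis last_ix 1) = weight T t"
  by (rule weight_eqI) (simp add: axis_def)

lemma weight_dual_objective [simp]: "weight T (dual_objective \<Gamma> S T t) = weight T t"
  by (rule weight_eqI) (simp add: dual_objective_def)

text \<open>The fixed entry 1 makes the weight affine rather than linear, which is where
  \<open>u + v = 1\<close> enters.\<close>

lemma weight_convex_combination:
  assumes "u + v = 1"
  shows "weight T (u *\<^sub>R a + v *\<^sub>R b) = u *\<^sub>R weight T a + v *\<^sub>R weight T b"
proof -
  have "with_last_one (u *\<^sub>R a + v *\<^sub>R b) = u *\<^sub>R with_last_one a + v *\<^sub>R with_last_one b"
    using assms by (auto simp: with_last_one_def vec_eq_iff)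
  then show ?thesis
    by (simp add: weight_def vector_matrix_left_distrib scaleR_vector_matrix_assoc)
qed

lemma coupling_weight: "coupling T y t = weight T t \<bullet> y - t $ last_ix"
  by (simp add: coupling_def weight_def)

lemma coupling_convex_combination:
  assumes "u + v = 1"
  shows "coupling T y (u *\<^sub>R a + v *\<^sub>R b) = u * coupling T y a + v * coupling T y b"
  by (simp add: coupling_weight weight_convex_combination[OF assms] inner_add_left algebra_simps)

text \<open>Far enough up the last axis the coupling is negative. Thus a pass of the algorithm ends
  with \<open>M = UNIV\<close> exactly if it made no cut.\<close>

lemma cut_neq_UNIV: "cut T y \<noteq> UNIV"
proof -
  have "coupling T y ((weight T 0 \<bullet> y + 1) *\<^sub>R axis last_ix 1) < 0"
    using weight_add_last[of T 0 "weight T 0 \<bullet> y + 1"]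
    by (simp add: coupling_weight axis_def)
  then show ?thesis unfolding cut_def by (auto simp: set_eq_iff not_le)
qed

section \<open>Convex hulls extended downward along the last axis\<close>

lemma dual_order_cone_iff: "a \<in> dual_order_cone \<longleftrightarrow> (\<exists>s\<ge>0. a = s *\<^sub>R axis last_ix 1)"
  by (auto simp: dual_order_cone_def)

lemma convex_dual_order_cone: "convex dual_order_cone"
proof (rule convexI)
  fix a b :: "'a rvec" and u v :: real
  assume "a \<in> dual_order_cone" "b \<in> dual_order_cone" "0 \<le> u" "0 \<le> v"
  then obtain r s where "r \<ge> 0" "a = r *\<^sub>R axis last_ix 1" "s \<ge> 0" "b = s *\<^sub>R axis last_ix 1"
    by (auto simp: dual_order_cone_iff)
  then show "u *\<^sub>R a + v *\<^sub>R b \<in> dual_order_cone"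
    using \<open>0 \<le> u\<close> \<open>0 \<le> v\<close> unfolding dual_order_cone_iff
    by (intro exI[of _ "u * r + v * s"]) (simp add: scaleR_add_left)
qed

text \<open>The right-hand side of the inclusion in \<open>finite_eps_solution_dual\<close>, with an
  arbitrary set in place of the dual objective values.\<close>

definition below_hull :: "'q rvec set \<Rightarrow> real \<Rightarrow> 'q::{finite,linorder} rvec set"
  where "below_hull A \<epsilon> =
    {a - k + \<epsilon> *\<^sub>R axis last_ix 1 | a k. a \<in> convex hull A \<and> k \<in> dual_order_cone}"

lemma convex_below_hull: "convex (below_hull A \<epsilon>)"
proof -
  have "below_hull A \<epsilon> =
      (\<lambda>p. \<epsilon> *\<^sub>R axis last_ix 1 + p) ` (\<Union>a\<in>convex hull A. \<Union>k\<in>dual_order_cone. {a - k})"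
    unfolding below_hull_def by (force simp: add.commute)
  then show ?thesis
    by (simp add: convex_translation convex_differences convex_dual_order_cone)
qed

lemma below_hull_downward:
  assumes "p \<in> below_hull A \<epsilon>" and "s \<ge> 0"
  shows "p - s *\<^sub>R axis last_ix 1 \<in> below_hull A \<epsilon>"
proof -
  obtain a r where "a \<in> convex hull A" "r \<ge> 0"
      "p = a - r *\<^sub>R axis last_ix 1 + \<epsilon> *\<^sub>R axis last_ix 1"
    using assms(1) by (auto simp: below_hull_def dual_order_cone_iff)
  then have "p - s *\<^sub>R axis last_ix 1 = a - (r + s) *\<^sub>R axis last_ix 1 + \<epsilon> *\<^sub>R axis last_ix 1"
    by (simp add: scaleR_add_left)
  moreover have "(r + s) *\<^sub>R axis last_ix 1 \<in> dual_order_cone"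
    unfolding dual_order_cone_iff using \<open>r \<ge> 0\<close> assms(2) by (intro exI[of _ "r + s"]) simp
  ultimately show ?thesis unfolding below_hull_def using \<open>a \<in> _\<close> by blast
qed

section \<open>The dual cone and its base\<close>

lemma dual_cone_norm_le_inner:
  fixes d :: "real ^ 'q"
  assumes "w \<in> dual_cone C" "cball d r \<subseteq> C" "r \<ge> 0"
  shows "r * norm w \<le> w \<bullet> d"
proof (cases "w = 0")
  case False
  \<comment> \<open>The point of the ball that lies farthest against \<open>w\<close> gives the
    sharpest test.\<close>
  have "d - (r / norm w) *\<^sub>R w \<in> cball d r"
    using False assms(3) by (simp add: dist_norm)
  then have "0 \<le> w \<bullet> (d - (r / norm w) *\<^sub>R w)"
    using assms(1,2) unfolding dual_cone_def by blast
  also have "\<dots> = w \<bullet> d - r * norm w"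
    using False by (simp add: inner_diff_right dot_square_norm power2_eq_square)
  finally show ?thesis by simp
qed simp

lemma inner_interior_cone_pos:
  fixes d :: "real ^ 'q"
  assumes "w \<in> dual_cone C" "w \<noteq> 0" "d \<in> interior C"
  shows "w \<bullet> d > 0"
proof -
  obtain r where r: "r > 0" "cball d r \<subseteq> C"
    using assms(3) mem_interior_cball by blast
  have "0 < r * norm w" using r assms(2) by simp
  also have "\<dots> \<le> w \<bullet> d" using dual_cone_norm_le_inner[OF assms(1) r(2)] r(1) by simp
  finally show ?thesis .
qed

lemma bounded_dual_cone_base:
  fixes c :: "real ^ 'q"
  assumes "c \<in> interior C"
  shows "bounded {w \<in> dual_cone C. w \<bullet> c = 1}"
proof -
  obtain r where r: "r > 0" "cball c r \<subseteq> C"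
    using assms mem_interior_cball by blast
  have "norm w \<le> 1 / r" if "w \<in> dual_cone C" "w \<bullet> c = 1" for w
    using dual_cone_norm_le_inner[OF that(1) r(2)] r(1) that(2) by (simp add: field_simps)
  then show ?thesis unfolding bounded_iff by blast
qed

lemma convex_cone_dual_cone: "convex_cone (dual_cone C)"
  by (auto simp: convex_cone_iff dual_cone_def inner_add_left)

lemma closed_dual_cone: "closed (dual_cone C)"
proof -
  have "dual_cone C = (\<Inter>y\<in>C. {z. y \<bullet> z \<ge> 0})"
    by (auto simp: dual_cone_def inner_commute)
  then show ?thesis by (simp add: closed_INT closed_halfspace_ge)
qed

lemma mem_dual_cone_if_bounded_below:
  assumes "convex_cone C" and "\<And>d. d \<in> C \<Longrightarrow> w \<bullet> d > b"
  shows "w \<in> dual_cone C"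
proof (rule ccontr)
  assume "w \<notin> dual_cone C"
  then obtain d where d: "d \<in> C" "w \<bullet> d < 0"
    by (auto simp: dual_cone_def not_le)
  \<comment> \<open>The factor makes the inner product with \<open>w\<close> equal to
    \<open>- \<bar>b\<bar>\<close>, which is at most \<open>b\<close>.\<close>
  have "(\<bar>b\<bar> / - (w \<bullet> d)) *\<^sub>R d \<in> C"
    using assms(1) d by (intro convex_cone_scaleR) 
      (auto intro: divide_nonneg_pos simp del: divide_minus_right)
  then have "b < w \<bullet> ((\<bar>b\<bar> / - (w \<bullet> d)) *\<^sub>R d)" by (rule assms(2))
  with d show False by simp
qed

text \<open>The normal of a hyperplane that separates \<open>C\<close> from a point outside is
  bounded below on \<open>C\<close>, hence a nonzero dual vector. This later excludes an empty list
  of generators.\<close>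

lemma dual_cone_nontrivial:
  assumes "closed C" "convex_cone C" "C \<noteq> UNIV"
  shows "dual_cone C \<noteq> {0}"
proof -
  obtain y where "y \<notin> C" using assms(3) by auto
  moreover have "convex C" using assms(2) by (simp add: convex_cone_def)
  ultimately obtain w b where w: "w \<bullet> y < b" "\<forall>d\<in>C. w \<bullet> d > b"
    using separating_hyperplane_closed_point[of C y] assms(1) by blast
  then have "w \<in> dual_cone C"
    using mem_dual_cone_if_bounded_below[OF assms(2)] by blast
  moreover have "w \<noteq> 0"
    using w convex_cone_contains_0[OF assms(2)] by fastforce
  ultimately show ?thesis by auto
qed

lemma invertible_matrix_of_columns:
  fixes b :: "'q::finite \<Rightarrow> real ^ 'q"
  assumes "inj b" "independent (range b)"
  shows "invertible (matrix_of_columns b)"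
  unfolding invertible_left_inverse matrix_left_invertible_independent_columns
proof (intro allI impI)
  fix u :: "'q \<Rightarrow> real" and i
  assume "(\<Sum>i\<in>UNIV. u i *s column i (matrix_of_columns b)) = 0"
  moreover have "column i (matrix_of_columns b) = b i" for i
    by (simp add: column_def matrix_of_columns_def vec_eq_iff)
  ultimately have "(\<Sum>i\<in>UNIV. u i *\<^sub>R b i) = 0"
    by (simp add: scalar_mult_eq_scaleR)
  \<comment> \<open>Injectivity of \<open>b\<close> turns the sum over indices into a linear
    combination over the set of columns, as independence requires.\<close>
  also have "(\<Sum>i\<in>UNIV. u i *\<^sub>R b i) = (\<Sum>v\<in>range b. u (inv b v) *\<^sub>R v)"
    using assms(1) by (simp add: sum.reindex)
  finally have "u (inv b (b i)) = 0"
    using assms(2) independentD[of "range b" "range b" "\<lambda>v. u (inv b v)" "b i"] by auto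
  then show "u i = 0" using assms(1) by simp
qed

section \<open>Scalarization, weak minimizers and dual maximizers\<close>

locale geometric_duality =
  fixes C :: "'q::{finite,linorder} rvec set"
    and \<Gamma> :: "real ^ 'n \<Rightarrow> 'q rvec"
    and S :: "(real ^ 'n) set"
    and T :: "'q rmat"
    and c :: "'q rvec"
  assumes closed_C: "closed C"
    and cone_C: "convex_cone C"
    and c_interior: "c \<in> interior C"
    and invertible_T: "invertible T"
    and last_column: "T *v axis last_ix 1 = c"
    and S_nonempty: "S \<noteq> {}"
    and compact_S: "compact S"
    and continuous_\<Gamma>: "continuous_on S \<Gamma>"
begin

text \<open>This ties the normalization \<open>w \<bullet> c = 1\<close> to the entry 1 set by
  \<open>with_last_one\<close>, so that every \<open>w\<close> with \<open>w \<bullet> c = 1\<close>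
  is the weight of \<open>w v* T\<close>.\<close>

lemma vector_matrix_mult_last: "(w v* T) $ last_ix = w \<bullet> c"
  unfolding last_column[symmetric] dot_lmul_matrix[symmetric] by (simp add: inner_axis)

lemma weight_inner_c: "weight T t \<bullet> c = 1"
  unfolding vector_matrix_mult_last[symmetric] weight_vector_matrix_mult[OF invertible_T]
  by (simp add: with_last_one_def)

lemma weight_of_normalized:
  assumes "w \<bullet> c = 1"
  shows "weight T (w v* T) = w"
  using weight_of_vector_matrix_mult[OF invertible_T] assms by (simp add: vector_matrix_mult_last)

text \<open>Makes every \<open>INF\<close> below a true infimum instead of an unspecified
  value.\<close>

lemma bdd_below_scalarization: "bdd_below ((\<lambda>x. w \<bullet> \<Gamma> x) ` S)"
proof -
  have "compact ((\<lambda>x. w \<bullet> \<Gamma> x) ` S)"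
    by (intro compact_continuous_image continuous_intros continuous_\<Gamma> compact_S)
  then show ?thesis by (simp add: bounded_imp_bdd_below compact_imp_bounded)
qed

lemma le_INF_iff_scalarization:
  "b \<le> (INF x\<in>S. w \<bullet> \<Gamma> x) \<longleftrightarrow> (\<forall>x\<in>S. b \<le> w \<bullet> \<Gamma> x)"
  using le_cINF_iff[OF S_nonempty bdd_below_scalarization] by blast

lemma INF_eq_scalar_opt:
  assumes "scalar_opt \<Gamma> S w x"
  shows "(INF x\<in>S. w \<bullet> \<Gamma> x) = w \<bullet> \<Gamma> x"
proof (rule antisym)
  show "(INF x\<in>S. w \<bullet> \<Gamma> x) \<le> w \<bullet> \<Gamma> x"
    using assms by (auto simp: scalar_opt_def intro: cINF_lower[OF bdd_below_scalarization])
  show "w \<bullet> \<Gamma> x \<le> (INF x\<in>S. w \<bullet> \<Gamma> x)"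
    using assms by (auto simp: le_INF_iff_scalarization scalar_opt_def)
qed

lemma mem_lower_image_iff:
  "t \<in> lower_image C \<Gamma> S T \<longleftrightarrow>
    t \<in> dual_feasible C T \<and> (\<forall>x\<in>S. coupling T (\<Gamma> x) t \<ge> 0)"
  by (auto simp: lower_image_def dual_feasible_def le_INF_iff_scalarization coupling_weight)

text \<open>Objective vectors comparable under \<open>dual_order_cone\<close> differ at most in the
  last coordinate, so their arguments have the same weight. The last coordinate depends on the
  weight alone, hence the vectors coincide and no feasible point is dominated.\<close>

lemma dual_feasible_is_maximizer:
  assumes "t \<in> dual_feasible C T"
  shows "dual_maximizer C \<Gamma> S T t"
proof -
  have "dual_objective \<Gamma> S T t' = dual_objective \<Gamma> S T t"
    if le: "cone_le dual_order_cone (dual_objective \<Gamma> S T t) (dual_objective \<Gamma> S T t')" for t'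
  proof -
    obtain s where
      s: "dual_objective \<Gamma> S T t' - dual_objective \<Gamma> S T t = s *\<^sub>R axis last_ix 1"
      using le by (auto simp: cone_le_def dual_order_cone_iff)
    have eq: "t' $ i = t $ i" if "i \<noteq> last_ix" for i
      using arg_cong[OF s, of "\<lambda>v. v $ i"] that by (simp add: dual_objective_def axis_def)
    then have "weight T t' = weight T t" by (rule weight_eqI)
    then show ?thesis using eq unfolding vec_eq_iff[of "dual_objective \<Gamma> S T t'"]
      by (simp add: dual_objective_def)
  qed
  then show ?thesis using assms by (auto simp: dual_maximizer_def)
qed

text \<open>The property kept for every point that the algorithm collects; it implies weak
  minimality.\<close>

definition base_optimal :: "real ^ 'n \<Rightarrow> bool"
  where "base_optimal x \<longleftrightarrow> (\<exists>w\<in>dual_cone C. w \<bullet> c = 1 \<and> scalar_opt \<Gamma> S w x)"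

lemma base_optimal_imp_weak_minimizer:
  assumes "base_optimal x"
  shows "weak_minimizer C \<Gamma> S x"
proof -
  obtain w where w: "w \<in> dual_cone C" "w \<bullet> c = 1" "scalar_opt \<Gamma> S w x"
    using assms by (auto simp: base_optimal_def)
  then have "w \<noteq> 0" by auto
  have False if "d \<in> interior C" "\<Gamma> x - d = \<Gamma> x'" "x' \<in> S" for d x'
  proof -
    have "w \<bullet> d > 0" using inner_interior_cone_pos w(1) \<open>w \<noteq> 0\<close> that(1) by blast
    moreover have "w \<bullet> \<Gamma> x \<le> w \<bullet> (\<Gamma> x - d)"
      using w(3) that by (auto simp: scalar_opt_def)
    ultimately show False by (simp add: inner_diff_right)
  qed
  then show ?thesis using w(3) by (fastforce simp: weak_minimizer_def scalar_opt_def)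
qed

section \<open>Outer approximations and their vertices\<close>

definition outer :: "'q rvec set \<Rightarrow> 'q rvec set"
  where "outer Y = dual_feasible C T \<inter> (\<Inter>y\<in>Y. cut T y)"

lemma mem_outer_iff:
  "t \<in> outer Y \<longleftrightarrow> t \<in> dual_feasible C T \<and> (\<forall>y\<in>Y. coupling T y t \<ge> 0)"
  by (auto simp: outer_def cut_def)

text \<open>The lower image and the polyhedra of the algorithm thus arise from one construction: the
  former takes all feasible values as cut points, the latter finitely many.\<close>

lemma lower_image_eq_outer: "lower_image C \<Gamma> S T = outer (\<Gamma> ` S)"
  by (auto simp: mem_lower_image_iff mem_outer_iff)

lemma convex_dual_feasible: "convex (dual_feasible C T)"
  unfolding convex_def dual_feasible_def
  using convex_cone_dual_cone[of C] by (auto simp: weight_convex_combination convex_cone_iff)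

lemma convex_outer: "convex (outer Y)"
  using convex_dual_feasible
  by (auto simp: convex_def mem_outer_iff coupling_convex_combination)

lemma continuous_weight: "continuous_on A (weight T)"
proof -
  have "continuous_on A (\<lambda>t::'q rvec. if i = last_ix then 1 else t $ i)" for i
    by (cases "i = last_ix") (auto intro: continuous_intros)
  then have "continuous_on A (with_last_one :: 'q rvec \<Rightarrow> 'q rvec)"
    unfolding with_last_one_def by (intro continuous_on_vec_lambda)
  moreover have "weight T = (\<lambda>t. transpose (matrix_inv T) *v with_last_one t)"
    by (simp add: weight_def fun_eq_iff)
  ultimately show ?thesis
    by (simp del: transpose_matrix_vector add: linear_continuous_on_compose)
qed

lemma continuous_coupling: "continuous_on A (coupling T y)"
  unfolding coupling_weight[abs_def] by (intro continuous_intros continuous_weight)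

lemma closed_outer: "closed (outer Y)"
proof -
  have "closed (weight T -` dual_cone C)"
    using continuous_weight closed_dual_cone by (metis closed_vimage)
  moreover have "closed (cut T y)" for y
    unfolding cut_def by (intro closed_Collect_le continuous_coupling continuous_intros)
  ultimately show ?thesis
    by (auto simp: outer_def dual_feasible_def vimage_def)
qed

definition active_face :: "'q rvec set \<Rightarrow> 'q rvec \<Rightarrow> 'q rvec set"
  where "active_face Y y = outer Y \<inter> {t. coupling T y t = 0}"

text \<open>The coupling with \<open>y\<close> is affine and nonnegative on \<open>outer Y\<close>,
  so it can vanish inside a segment only if it vanishes at both ends.\<close>

lemma active_face_face_of:
  assumes "y \<in> Y"
  shows "active_face Y y face_of outer Y"
  unfolding face_of_def
proof (intro conjI ballI impI)
  show "active_face Y y \<subseteq> outer Y" by (auto simp: active_face_def)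
  show "convex (active_face Y y)"
    using convex_outer[of Y] by (auto simp: convex_def active_face_def coupling_convex_combination)
  fix a b x
  assume ab: "a \<in> outer Y" "b \<in> outer Y" and x: "x \<in> active_face Y y" "x \<in> open_segment a b"
  then obtain u where u: "0 < u" "u < 1" "x = (1 - u) *\<^sub>R a + u *\<^sub>R b"
    by (auto simp: in_segment)
  have "(1 - u) * coupling T y a + u * coupling T y b = 0"
    using x u coupling_convex_combination[of "1 - u" u T y a b] by (simp add: active_face_def)
  moreover have "coupling T y a \<ge> 0" "coupling T y b \<ge> 0"
    using ab assms by (auto simp: mem_outer_iff)
  ultimately have "coupling T y a = 0 \<and> coupling T y b = 0"
    using u by (smt (verit) mult_nonneg_nonneg mult_pos_pos)
  then show "a \<in> active_face Y y" "b \<in> active_face Y y"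
    using ab by (auto simp: active_face_def)
qed

text \<open>On the face the last coordinate is \<open>weight T t \<bullet> y\<close>, so a point is
  determined by its weight and depends continuously on it. The weights lie in the compact
  base.\<close>

lemma compact_active_face: "compact (active_face Y y)"
proof -
  let ?B = "{w \<in> dual_cone C. w \<bullet> c = 1}"
  \<comment> \<open>The last coordinate of \<open>w v* T\<close> is 1 on the base; the correction
    replaces it by \<open>w \<bullet> y\<close>.\<close>
  let ?f = "\<lambda>w. w v* T + (w \<bullet> y - 1) *\<^sub>R axis last_ix 1"
  have "active_face Y y \<subseteq> ?f ` ?B"
  proof
    fix t assume t: "t \<in> active_face Y y"
    have "?f (weight T t) = t"
      unfolding weight_vector_matrix_mult[OF invertible_T]
      using t by (auto simp: vec_eq_iff with_last_one_def axis_def active_face_def coupling_weight)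
    moreover have "weight T t \<in> ?B"
      using t by (simp add: active_face_def mem_outer_iff dual_feasible_def weight_inner_c)
    ultimately show "t \<in> ?f ` ?B" by force
  qed
  moreover have "compact ?B"
  proof -
    have "closed ?B"
      using closed_Int[OF closed_dual_cone closed_hyperplane, of C c 1]
      by (simp add: Int_def inner_commute)
    then show ?thesis
      using bounded_dual_cone_base[OF c_interior] by (simp add: compact_eq_bounded_closed)
  qed
  moreover have "continuous_on ?B ?f"
    unfolding transpose_matrix_vector[symmetric]
    by (intro continuous_intros linear_continuous_on) auto
  ultimately have "bounded (active_face Y y)"
    by (meson bounded_subset compact_continuous_image compact_imp_bounded)
  moreover have "closed (active_face Y y)"
    unfolding active_face_def
    by (intro closed_Int closed_outer closed_Collect_eq continuous_coupling continuous_intros)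
  ultimately show ?thesis by (simp add: compact_eq_bounded_closed)
qed

text \<open>Krein-Milman applies to the compact face, and extreme points of a face are extreme in
  the whole set.\<close>

lemma active_face_subset_hull_vertices:
  assumes "y \<in> Y"
  shows "active_face Y y \<subseteq> convex hull (vertices (outer Y))"
proof -
  have "convex (active_face Y y)"
    using active_face_face_of[OF assms] by (simp add: face_of_def)
  then have "active_face Y y = convex hull {v. v extreme_point_of active_face Y y}"
    by (intro Krein_Milman_Minkowski compact_active_face)
  also have "\<dots> \<subseteq> convex hull (vertices (outer Y))"
    using extreme_point_of_face[OF active_face_face_of[OF assms]]
    by (intro hull_mono) (auto simp: vertices_def)
  finally show ?thesis .
qed

text \<open>Raising \<open>t\<close> by its smallest coupling lowers all couplings equally, so none
  becomes negative and the smallest becomes zero.\<close>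

lemma outer_point_below_active_face:
  assumes "finite Y" "Y \<noteq> {}" "t \<in> outer Y"
  obtains y s where "y \<in> Y" "s \<ge> 0" "t + s *\<^sub>R axis last_ix 1 \<in> active_face Y y"
proof -
  define s where "s = Min ((\<lambda>y. coupling T y t) ` Y)"
  have "s \<in> (\<lambda>y. coupling T y t) ` Y"
    unfolding s_def using assms by (intro Min_in) auto
  then obtain y where y: "y \<in> Y" "coupling T y t = s" by auto
  have le: "s \<le> coupling T y' t" if "y' \<in> Y" for y'
    unfolding s_def using assms(1) that by auto
  have shift: "coupling T y' (t + s *\<^sub>R axis last_ix 1) = coupling T y' t - s" for y'
    by (simp add: coupling_weight)
  have "t + s *\<^sub>R axis last_ix 1 \<in> active_face Y y"
    using assms(3) y le by (auto simp: active_face_def mem_outer_iff shift dual_feasible_def)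
  moreover have "s \<ge> 0" using assms(3) y by (auto simp: mem_outer_iff)
  ultimately show thesis using y that by blast
qed

lemma outer_subset_below_hull:
  assumes "finite Y" "Y \<noteq> {}"
    and vertices: "\<And>v. v \<in> vertices (outer Y) \<Longrightarrow>
      v \<in> Ts \<and> v $ last_ix - (INF x\<in>S. weight T v \<bullet> \<Gamma> x) \<le> \<epsilon>"
  shows "outer Y \<subseteq> below_hull (dual_objective \<Gamma> S T ` Ts) \<epsilon>"
proof
  let ?H = "below_hull (dual_objective \<Gamma> S T ` Ts) \<epsilon>"
  have "vertices (outer Y) \<subseteq> ?H"
  proof
    fix v assume "v \<in> vertices (outer Y)"
    note v = vertices[OF this]
    \<comment> \<open>The part of the tolerance that the gap at \<open>v\<close> leaves over; it is
      nonnegative by assumption.\<close>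
    define s where "s = \<epsilon> - (v $ last_ix - (INF x\<in>S. weight T v \<bullet> \<Gamma> x))"
    have "s *\<^sub>R axis last_ix 1 \<in> dual_order_cone"
      using v by (auto simp: s_def dual_order_cone_iff)
    moreover have "dual_objective \<Gamma> S T v \<in> convex hull (dual_objective \<Gamma> S T ` Ts)"
      using v by (simp add: hull_inc)
    moreover have
      "v = dual_objective \<Gamma> S T v - s *\<^sub>R axis last_ix 1 + \<epsilon> *\<^sub>R axis last_ix 1"
      by (simp add: vec_eq_iff dual_objective_def s_def axis_def)
    ultimately show "v \<in> ?H" unfolding below_hull_def by blast
  qed
  then have hull: "convex hull (vertices (outer Y)) \<subseteq> ?H"
    by (simp add: convex_below_hull subset_hull)
  fix t assume "t \<in> outer Y"
  then obtain y s where "y \<in> Y" "s \<ge> 0" "t + s *\<^sub>R axis last_ix 1 \<in> active_face Y y"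
    using outer_point_below_active_face assms(1,2) by blast
  then have "t + s *\<^sub>R axis last_ix 1 \<in> ?H"
    using active_face_subset_hull_vertices hull by blast
  from below_hull_downward[OF this \<open>s \<ge> 0\<close>] show "t \<in> ?H" by simp
qed

section \<open>From the lower image to the upper image\<close>

lemma below_hull_shift_in_lower_image:
  assumes "Ts \<subseteq> dual_feasible C T" "p \<in> below_hull (dual_objective \<Gamma> S T ` Ts) \<epsilon>"
  shows "p - \<epsilon> *\<^sub>R axis last_ix 1 \<in> lower_image C \<Gamma> S T"
proof -
  \<comment> \<open>The objective values lie in the lower image, which is convex and closed
    downward, so only the shift by \<epsilon> has to be undone.\<close>
  have "dual_objective \<Gamma> S T ` Ts \<subseteq> lower_image C \<Gamma> S T"
    using assms(1)
    by (auto simp: lower_image_def dual_feasible_def) (simp add: dual_objective_def)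
  then have "convex hull (dual_objective \<Gamma> S T ` Ts) \<subseteq> lower_image C \<Gamma> S T"
    by (simp add: lower_image_eq_outer convex_outer subset_hull)
  with assms(2) obtain a s where a: "a \<in> lower_image C \<Gamma> S T" and s: "s \<ge> 0"
    and p: "p - \<epsilon> *\<^sub>R axis last_ix 1 = a - s *\<^sub>R axis last_ix 1"
    by (auto simp: below_hull_def dual_order_cone_iff)
  show ?thesis
    unfolding p using a s by (simp add: lower_image_def)
qed

lemma separating_normalized_weight:
  assumes "finite Xs" "Xs \<noteq> {}" "Xs \<subseteq> S"
    and "y \<notin> {a + d - \<epsilon> *\<^sub>R c | a d. a \<in> convex hull (\<Gamma> ` Xs) \<and> d \<in> C}"
  obtains w b where "w \<in> dual_cone C" "w \<bullet> c = 1" "w \<bullet> y < b"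
    "\<And>x. x \<in> Xs \<Longrightarrow> b + \<epsilon> < w \<bullet> \<Gamma> x"
proof -
  \<comment> \<open>The separation is between \<open>y + \<epsilon> *\<^sub>R c\<close> and the sum
    of a compact hull and the closed cone.\<close>
  let ?A = "\<Union>a\<in>convex hull (\<Gamma> ` Xs). \<Union>d\<in>C. {a + d}"
  have "convex ?A"
    using cone_C by (intro convex_sums) (auto simp: convex_cone_def)
  moreover have "closed ?A"
    using assms(1) closed_C
    by (intro compact_closed_sums) (auto simp: finite_imp_compact_convex_hull)
  moreover have "y + \<epsilon> *\<^sub>R c \<notin> ?A"
  proof
    assume "y + \<epsilon> *\<^sub>R c \<in> ?A"
    then obtain a d where "a \<in> convex hull (\<Gamma> ` Xs)" "d \<in> C" "y + \<epsilon> *\<^sub>R c = a + d" by auto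
    then have "y = a + d - \<epsilon> *\<^sub>R c" by (simp add: algebra_simps)
    then show False using assms(4) \<open>a \<in> _\<close> \<open>d \<in> C\<close> by blast
  qed
  ultimately have "\<exists>w b. w \<bullet> (y + \<epsilon> *\<^sub>R c) < b \<and> (\<forall>p\<in>?A. w \<bullet> p > b)"
    by (rule separating_hyperplane_closed_point)
  then obtain w b where w: "w \<bullet> (y + \<epsilon> *\<^sub>R c) < b" "\<forall>p\<in>?A. b < w \<bullet> p"
    by (elim exE conjE)
  have bx: "b < w \<bullet> \<Gamma> x + w \<bullet> d" if "x \<in> Xs" "d \<in> C" for x d
  proof -
    have "\<Gamma> x + d \<in> ?A" using that by (auto intro: hull_inc)
    from bspec[OF w(2) this] show ?thesis by (simp add: inner_add_right)
  qed
  obtain x0 where x0: "x0 \<in> Xs" using assms(2) by auto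
  \<comment> \<open>With one hull point fixed, the separation bounds \<open>w\<close> from below on
    the cone.\<close>
  have dual: "w \<in> dual_cone C"
    by (rule mem_dual_cone_if_bounded_below[OF cone_C, where b = "b - w \<bullet> \<Gamma> x0"])
       (use bx[OF x0] in fastforce)
  have zero: "0 \<in> C" by (rule convex_cone_contains_0[OF cone_C])
  have "w \<noteq> 0"
    using w(1) bx[OF x0 zero] by auto
  then have pos: "w \<bullet> c > 0" by (rule inner_interior_cone_pos[OF dual _ c_interior])
  show thesis
  \<comment> \<open>After division by \<open>w \<bullet> c\<close> the shift of \<open>y\<close> by
    \<open>\<epsilon> *\<^sub>R c\<close> contributes exactly \<epsilon>, which is moved to the
    bound.\<close>
  proof (rule that[of "(1 / (w \<bullet> c)) *\<^sub>R w" "b / (w \<bullet> c) - \<epsilon>"])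
    show "(1 / (w \<bullet> c)) *\<^sub>R w \<in> dual_cone C"
      using pos dual by (intro convex_cone_scaleR[OF convex_cone_dual_cone]) auto
    show "(1 / (w \<bullet> c)) *\<^sub>R w \<bullet> c = 1" using pos by simp
    show "(1 / (w \<bullet> c)) *\<^sub>R w \<bullet> y < b / (w \<bullet> c) - \<epsilon>"
      using pos w(1) by (simp add: inner_add_right field_simps)
    show "b / (w \<bullet> c) - \<epsilon> + \<epsilon> < (1 / (w \<bullet> c)) *\<^sub>R w \<bullet> \<Gamma> x" if "x \<in> Xs" for x
      using pos bx[OF that zero] by (simp add: field_simps)
  qed
qed

lemma upper_image_inner_ge:
  assumes "w \<in> dual_cone C" "\<forall>x\<in>S. b \<le> w \<bullet> \<Gamma> x" "y \<in> upper_image C \<Gamma> S"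
  shows "b \<le> w \<bullet> y"
proof -
  have "{\<Gamma> x + d | x d. x \<in> S \<and> d \<in> C} \<subseteq> {y. b \<le> w \<bullet> y}"
    using assms(1,2) by (fastforce simp: dual_cone_def inner_add_right)
  then have "upper_image C \<Gamma> S \<subseteq> {y. b \<le> w \<bullet> y}"
    unfolding upper_image_def by (rule closure_minimal) (use closed_halfspace_ge[of b w] in simp)
  then show ?thesis using assms(3) by auto
qed

lemma upper_image_subset_if_outer_subset:
  assumes "finite Xs" "Xs \<noteq> {}" "Xs \<subseteq> S" "Ts \<subseteq> dual_feasible C T"
    and outer: "outer (\<Gamma> ` Xs) \<subseteq> below_hull (dual_objective \<Gamma> S T ` Ts) \<epsilon>"
  shows "upper_image C \<Gamma> S \<subseteq> {a + d - \<epsilon> *\<^sub>R c | a d. a \<in> convex hull (\<Gamma> ` Xs) \<and> d \<in> C}"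
proof (rule ccontr)
  assume "\<not> ?thesis"
  then obtain y where y: "y \<in> upper_image C \<Gamma> S"
    and "y \<notin> {a + d - \<epsilon> *\<^sub>R c | a d. a \<in> convex hull (\<Gamma> ` Xs) \<and> d \<in> C}" by blast
  then obtain w b where w: "w \<in> dual_cone C" "w \<bullet> c = 1" "w \<bullet> y < b"
    and b: "\<And>x. x \<in> Xs \<Longrightarrow> b + \<epsilon> < w \<bullet> \<Gamma> x"
    using separating_normalized_weight[OF assms(1-3)] by blast
  \<comment> \<open>The point with weight \<open>w\<close> and last coordinate
    \<open>b + \<epsilon>\<close>; the 1 subtracted is the last coordinate of
    \<open>w v* T\<close>.\<close>
  define t where "t = w v* T + (b + \<epsilon> - 1) *\<^sub>R axis last_ix 1"
  have t: "weight T t = w" "t $ last_ix = b + \<epsilon>"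
    using w(2) by (simp_all add: t_def weight_of_normalized vector_matrix_mult_last)
  have "t \<in> outer (\<Gamma> ` Xs)"
    using w(1) b by (force simp: mem_outer_iff dual_feasible_def coupling_weight t)
  \<comment> \<open>Lowering \<open>t\<close> by \<epsilon> gives last coordinate \<open>b\<close>,
    so \<open>b\<close> bounds the scalarization on \<open>S\<close> and therefore on the whole
    upper image.\<close>
  then have "t - \<epsilon> *\<^sub>R axis last_ix 1 \<in> lower_image C \<Gamma> S T"
    using outer below_hull_shift_in_lower_image[OF assms(4)] by blast
  then have "\<forall>x\<in>S. b \<le> w \<bullet> \<Gamma> x"
    by (simp add: mem_lower_image_iff coupling_weight t)
  then have "b \<le> w \<bullet> y" using upper_image_inner_ge w(1) y by blast
  with w(3) show False by simp
qed

section \<open>Invariants of the algorithm\<close>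

lemma go_through_result:
  assumes "go_through C \<Gamma> S T \<epsilon> brk ts (Xs, Ts, M) (Xs', Ts', M')"
    and "set ts \<subseteq> dual_feasible C T"
  shows "\<exists>A B. finite A \<and> (\<forall>x\<in>A. base_optimal x) \<and> Xs' = Xs \<union> A \<and>
    B \<subseteq> A \<and> M' = M \<inter> (\<Inter>x\<in>B. cut T (\<Gamma> x)) \<and>
    Ts \<subseteq> Ts' \<and> Ts' \<subseteq> Ts \<union> set ts \<and>
    (M' = UNIV \<longrightarrow>
      (\<forall>t\<in>set ts. t \<in> Ts' \<and> t $ last_ix - (INF x\<in>S. weight T t \<bullet> \<Gamma> x) \<le> \<epsilon>))"
  using assms
\<comment> \<open>\<open>A\<close> holds the solutions computed in the pass and \<open>B\<close>
  those among them that caused a cut. The claim on all vertices is restricted to passes without a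
  cut.\<close>
proof (induction ts "(Xs, Ts, M)" "(Xs', Ts', M')" arbitrary: Xs Ts M rule: go_through.induct)
  case exhausted
  show ?case by (intro exI[of _ "{}"]) auto
next
  case (break_off t x ts)
  have "base_optimal x"
    using break_off weight_inner_c by (auto simp: base_optimal_def dual_feasible_def)
  moreover have "Xs' = insert x Xs" "M' = M \<inter> cut T (\<Gamma> x)" "Ts \<subseteq> Ts'" "Ts' \<subseteq> insert t Ts"
    using break_off by (auto simp: visit_vertex_def Let_def split: if_splits)
  \<comment> \<open>A break comes with a cut, so \<open>M'\<close> is not \<open>UNIV\<close> and
    nothing is claimed about the vertices left unvisited.\<close>
  ultimately show ?case
    using cut_neq_UNIV[of T "\<Gamma> x"] by (intro exI[of _ "{x}"]) auto
next
  case (go_on t x ts)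
  define gap where "gap \<longleftrightarrow> t $ last_ix - weight T t \<bullet> \<Gamma> x > \<epsilon>"
  define Ts1 where
    "Ts1 = (if weight T t \<notin> frontier (dual_cone C) \<or> \<not> gap then insert t Ts else Ts)"
  define M1 where "M1 = (if gap then M \<inter> cut T (\<Gamma> x) else M)"
  have "visit_vertex C \<Gamma> S T \<epsilon> t x (Xs, Ts, M) = (insert x Xs, Ts1, M1)"
    by (simp add: visit_vertex_def Let_def gap_def Ts1_def M1_def not_less)
  note IH = go_on.hyps(4)[OF this]
  have "set ts \<subseteq> dual_feasible C T" using go_on.prems by simp
  from IH[OF this] obtain A B where IH: "finite A" "\<forall>x\<in>A. base_optimal x" "Xs' = insert x Xs \<union> A" "B \<subseteq> A"
      "M' = M1 \<inter> (\<Inter>x\<in>B. cut T (\<Gamma> x))" "Ts1 \<subseteq> Ts'" "Ts' \<subseteq> Ts1 \<union> set ts"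
    and UNIV: "M' = UNIV \<Longrightarrow>
      \<forall>t\<in>set ts. t \<in> Ts' \<and> t $ last_ix - (INF x\<in>S. weight T t \<bullet> \<Gamma> x) \<le> \<epsilon>"
    by (elim exE conjE) (rule that, (assumption | blast)+)
  have x: "base_optimal x"
    using go_on.hyps(1) go_on.prems weight_inner_c
    by (auto simp: base_optimal_def dual_feasible_def)
  have INF: "(INF x\<in>S. weight T t \<bullet> \<Gamma> x) = weight T t \<bullet> \<Gamma> x"
    by (rule INF_eq_scalar_opt[OF go_on.hyps(1)])
  \<comment> \<open>Later steps only shrink \<open>M\<close>, so a cut made here could not be
    undone.\<close>
  have "\<not> gap" if "M' = UNIV"
    using that IH(5) cut_neq_UNIV[of T "\<Gamma> x"] by (auto simp: M1_def split: if_splits)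
  then have head: "t \<in> Ts' \<and> t $ last_ix - (INF x\<in>S. weight T t \<bullet> \<Gamma> x) \<le> \<epsilon>" if "M' = UNIV"
    using that IH(6) by (auto simp: INF gap_def Ts1_def)
  have M': "M' = M \<inter> (\<Inter>x\<in>(if gap then insert x B else B). cut T (\<Gamma> x))"
    using IH(5) by (auto simp: M1_def)
  have Ts: "Ts \<subseteq> Ts'" "Ts' \<subseteq> Ts \<union> set (t # ts)"
    using IH(6,7) by (auto simp: Ts1_def split: if_splits)
  have visited: "M' = UNIV \<longrightarrow>
      (\<forall>t\<in>set (t # ts). t \<in> Ts' \<and> t $ last_ix - (INF x\<in>S. weight T t \<bullet> \<Gamma> x) \<le> \<epsilon>)"
    using head UNIV by simp
  show ?case
  proof (intro exI conjI)
    show "finite (insert x A)" "\<forall>x\<in>insert x A. base_optimal x" "Xs' = Xs \<union> insert x A"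
      using IH(1-3) x by auto
    show "(if gap then insert x B else B) \<subseteq> insert x A" using IH(4) by auto
  qed (fact M' Ts visited)+
qed

lemma vertices_outer_feasible: "vertices (outer Y) \<subseteq> dual_feasible C T"
  by (auto simp: vertices_def extreme_point_of_def mem_outer_iff)

text \<open>Induction with the invariant that the current polyhedron is \<open>outer\<close> of the
  values of some nonempty \<open>A\<close> among the collected points. \<open>A\<close> may be
  smaller than \<open>Xs\<close> because not every computed solution causes a cut. In the final pass
  all vertices have gap at most \<epsilon> and were therefore added to \<open>Ts'\<close>.\<close>

lemma main_loop_result:
  assumes "main_loop C \<Gamma> S T \<epsilon> brk P Xs Ts Xs' Ts'"
    and "P = outer (\<Gamma> ` A)" "A \<noteq> {}" "A \<subseteq> Xs" "finite Xs" "\<forall>x\<in>Xs. base_optimal x"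
    and "finite Ts" "Ts \<noteq> {}" "Ts \<subseteq> dual_feasible C T"
  shows "\<exists>A'. A' \<noteq> {} \<and> A' \<subseteq> Xs' \<and> finite Xs' \<and> (\<forall>x\<in>Xs'. base_optimal x) \<and>
    finite Ts' \<and> Ts' \<noteq> {} \<and> Ts' \<subseteq> dual_feasible C T \<and>
    (\<forall>v\<in>vertices (outer (\<Gamma> ` A')).
      v \<in> Ts' \<and> v $ last_ix - (INF x\<in>S. weight T v \<bullet> \<Gamma> x) \<le> \<epsilon>)"
  using assms
proof (induction arbitrary: A rule: main_loop.induct)
  case (terminate ts P Xs Ts Xs' Ts' M)
  have feas: "set ts \<subseteq> dual_feasible C T"
    using terminate.hyps(2) terminate.prems(1) vertices_outer_feasible by simp
  from go_through_result[OF terminate.hyps(3) feas] terminate.hyps(4)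
  obtain A1 where "finite A1" "\<forall>x\<in>A1. base_optimal x" "Xs' = Xs \<union> A1"
      "Ts \<subseteq> Ts'" "Ts' \<subseteq> Ts \<union> set ts"
      "\<forall>t\<in>set ts. t \<in> Ts' \<and> t $ last_ix - (INF x\<in>S. weight T t \<bullet> \<Gamma> x) \<le> \<epsilon>"
    by auto
  note result = this
  show ?case
  proof (intro exI conjI)
    show "A \<noteq> {}" by (fact terminate.prems(2))
    show "A \<subseteq> Xs'" "finite Xs'" "\<forall>x\<in>Xs'. base_optimal x"
      using result(1-3) terminate.prems(3-5) by auto
    show "finite Ts'" using finite_subset[OF result(5)] terminate.prems(6) by simp
    show "Ts' \<noteq> {}" "Ts' \<subseteq> dual_feasible C T"
      using result(4,5) terminate.prems(7,8) feas by blast+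
  qed (use result(6) terminate.hyps(2) terminate.prems(1) in simp)
next
  case (iterate ts P Xs Ts Xs' Ts' M Xs'' Ts'')
  have feas: "set ts \<subseteq> dual_feasible C T"
    using iterate.hyps(2) iterate.prems(1) vertices_outer_feasible by simp
  from go_through_result[OF iterate.hyps(3) feas]
  obtain A1 B where A1: "finite A1" "\<forall>x\<in>A1. base_optimal x" "Xs' = Xs \<union> A1" "B \<subseteq> A1"
      and M: "M = (\<Inter>x\<in>B. cut T (\<Gamma> x))" and Ts': "Ts \<subseteq> Ts'" "Ts' \<subseteq> Ts \<union> set ts"
    by auto
  have "P \<inter> M = outer (\<Gamma> ` (A \<union> B))"
    using iterate.prems(1) M by (auto simp: outer_def)
  then show ?case
  proof (rule iterate.IH)
    show "finite Ts'"
      using finite_subset[OF Ts'(2)] iterate.prems(6) by simp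
    show "Ts' \<noteq> {}" "Ts' \<subseteq> dual_feasible C T"
      using Ts' iterate.prems(7,8) feas by blast+
    show "A \<union> B \<noteq> {}" "A \<union> B \<subseteq> Xs'" "finite Xs'" "\<forall>x\<in>Xs'. base_optimal x"
      using A1 iterate.prems(2-5) by auto
  qed
qed

theorem main_loop_correct:
  assumes "scalar_opt \<Gamma> S \<eta> x" "\<eta> \<in> dual_cone C" "\<eta> \<bullet> c = 1"
    and loop: "main_loop C \<Gamma> S T \<epsilon> brk (dual_feasible C T \<inter> cut T (\<Gamma> x))
      {x} {transpose T *v \<eta>} Xs Ts"
  shows "finite_weak_eps_solution C \<Gamma> S c \<epsilon> Xs \<and> finite_eps_solution_dual C \<Gamma> S T \<epsilon> Ts"
proof -
  have "base_optimal x" using assms(1-3) by (auto simp: base_optimal_def)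
  \<comment> \<open>The initial dual point is \<open>\<eta> v* T\<close>, whose weight is
    \<open>\<eta>\<close>.\<close>
  moreover have "transpose T *v \<eta> \<in> dual_feasible C T"
    using assms(2,3) by (simp add: dual_feasible_def weight_of_normalized)
  ultimately obtain A where A: "A \<noteq> {}" "A \<subseteq> Xs"
    and Xs: "finite Xs" "\<forall>x\<in>Xs. base_optimal x"
    and Ts: "finite Ts" "Ts \<noteq> {}" "Ts \<subseteq> dual_feasible C T"
    and vertices: "\<forall>v\<in>vertices (outer (\<Gamma> ` A)).
      v \<in> Ts \<and> v $ last_ix - (INF x\<in>S. weight T v \<bullet> \<Gamma> x) \<le> \<epsilon>"
    using main_loop_result[OF loop, of "{x}"] by (auto simp: outer_def)
  have weak: "\<forall>x\<in>Xs. weak_minimizer C \<Gamma> S x"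
    using Xs(2) base_optimal_imp_weak_minimizer by blast
  then have S: "Xs \<subseteq> S" by (auto simp: weak_minimizer_def)
  have A_hull: "outer (\<Gamma> ` A) \<subseteq> below_hull (dual_objective \<Gamma> S T ` Ts) \<epsilon>"
    using A vertices finite_subset[OF A(2) Xs(1)] by (intro outer_subset_below_hull) auto
  \<comment> \<open>More cut points give a smaller outer set, so the inclusion proved for
    \<open>A\<close> passes to \<open>Xs\<close> and to all of \<open>S\<close>.\<close>
  moreover have "outer (\<Gamma> ` Xs) \<subseteq> outer (\<Gamma> ` A)" "lower_image C \<Gamma> S T \<subseteq> outer (\<Gamma> ` A)"
    unfolding lower_image_eq_outer outer_def using A(2) S by blast+
  ultimately have "outer (\<Gamma> ` Xs) \<subseteq> below_hull (dual_objective \<Gamma> S T ` Ts) \<epsilon>"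
    and lower: "lower_image C \<Gamma> S T \<subseteq> below_hull (dual_objective \<Gamma> S T ` Ts) \<epsilon>"
    by auto
  then have "upper_image C \<Gamma> S \<subseteq> {a + d - \<epsilon> *\<^sub>R c | a d. a \<in> convex hull (\<Gamma> ` Xs) \<and> d \<in> C}"
    using A Xs(1) S Ts(3) by (intro upper_image_subset_if_outer_subset) auto
  then have "finite_weak_eps_solution C \<Gamma> S c \<epsilon> Xs"
    using A Xs(1) S weak by (auto simp: finite_weak_eps_solution_def)
  moreover have "finite_eps_solution_dual C \<Gamma> S T \<epsilon> Ts"
    using Ts lower dual_feasible_is_maximizer
    unfolding finite_eps_solution_dual_def below_hull_def by blast
  ultimately show ?thesis by blast
qed

end

theorem theorem4p14:
  fixes C :: "'q::{finite,linorder} rvec set"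
    and X :: "(real ^ 'n) set"
    and \<Gamma> :: "real ^ 'n \<Rightarrow> 'q rvec"
    and g :: "real ^ 'n \<Rightarrow> real ^ 'm"
    and c :: "'q rvec"
    and cs :: "'q \<Rightarrow> 'q rvec"
    and T :: "'q rmat"
    and J :: nat and z :: "nat \<Rightarrow> 'q rvec"
    and \<epsilon> :: real and brk :: bool
    and Xs :: "(real ^ 'n) set" and Ts :: "'q rvec set"
  assumes "polyhedron C" and "convex_cone C"
    and "{0} \<subset> C" and "C \<subset> UNIV"
    and "\<not> contains_line C" and "interior C \<noteq> {}"
    and "convex X"
    and "cone_convex_on C X \<Gamma>"
    and "\<And>i. convex_on X (\<lambda>x. g x $ i)"
    and "feasible X g \<noteq> {}"
    and "compact (feasible X g)"
    and "interior (feasible X g) \<noteq> {}"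
    and "continuous_on X \<Gamma>"
    and "c \<in> interior C"
    and "inj (cs(last_ix := c))" and "independent (range (cs(last_ix := c)))"
    and "T = matrix_of_columns (cs(last_ix := c))"
    and "convex_cone hull (z ` {1..J}) = dual_cone C"
    and "\<And>j. j \<in> {1..J} \<Longrightarrow> c \<bullet> z j = 1"
    and "\<epsilon> > 0"
    and "dual_algorithm_returns C \<Gamma> (feasible X g) T \<epsilon> brk J z Xs Ts"
  shows "finite_weak_eps_solution C \<Gamma> (feasible X g) c \<epsilon> Xs \<and>
    finite_eps_solution_dual C \<Gamma> (feasible X g) T \<epsilon> Ts"
proof -
  have closed: "closed C" by (rule polyhedron_imp_closed[OF assms(1)])
  interpret geometric_duality C \<Gamma> "feasible X g" T c
  proof
    show "invertible T"
      unfolding assms(17) by (rule invertible_matrix_of_columns[OF assms(15,16)])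
    show "T *v axis last_ix 1 = c"
      unfolding assms(17) matrix_vector_mult_basis
      by (simp add: column_def matrix_of_columns_def vec_eq_iff)
    show "continuous_on (feasible X g) \<Gamma>"
      using assms(13) by (rule continuous_on_subset) (auto simp: feasible_def)
  qed (use assms closed in auto)
  define \<eta> where "\<eta> = (1 / real J) *\<^sub>R (\<Sum>j=1..J. z j)"
  \<comment> \<open>For \<open>J = 0\<close> the average \<open>\<eta>\<close> would be 0 and could
    not be normalized; but no vectors generate only the trivial cone.\<close>
  have "J \<noteq> 0"
  proof
    assume "J = 0"
    then have "dual_cone C = convex_cone hull {}" using assms(18) by simp
    also have "\<dots> \<subseteq> {0}" by (rule hull_minimal) (auto simp: convex_cone_iff)
    finally have "dual_cone C = {0}"
      using convex_cone_contains_0[OF convex_cone_dual_cone, of C] by blast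
    then show False using dual_cone_nontrivial[OF closed assms(2)] assms(4) by blast
  qed
  have z: "z j \<in> dual_cone C" if "j \<in> {1..J}" for j
    unfolding assms(18)[symmetric] using that by (intro hull_inc) auto
  have "(\<Sum>j\<in>{1..J}. z j) \<in> dual_cone C"
    using z by (auto simp: dual_cone_def inner_sum_left intro!: sum_nonneg)
  then have "\<eta> \<in> dual_cone C"
    unfolding \<eta>_def by (intro convex_cone_scaleR[OF convex_cone_dual_cone]) auto
  moreover have "\<eta> \<bullet> c = 1"
  proof -
    have "(\<Sum>j=1..J. z j \<bullet> c) = (\<Sum>j=1..J. 1)"
      using assms(19) by (intro sum.cong) (auto simp: inner_commute)
    then show ?thesis
      using \<open>J \<noteq> 0\<close> by (simp add: \<eta>_def inner_sum_left)
  qed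
  moreover obtain x where "scalar_opt \<Gamma> (feasible X g) \<eta> x"
    "main_loop C \<Gamma> (feasible X g) T \<epsilon> brk (dual_feasible C T \<inter> cut T (\<Gamma> x))
      {x} {transpose T *v \<eta>} Xs Ts"
    using assms(21) by (auto simp: dual_algorithm_returns_def Let_def \<eta>_def)
  ultimately show ?thesis by (intro main_loop_correct)
qed

end
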